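(* Let $p$ be a prime and let $n\ge 1$ be an integer. Then $$\sum_{k\le n}\Delta(k,p)=\frac{1}{\pi^{2}(p+1)}\,n^{3}+O(n^{2}\log n)$$ and $$\frac{1}{n}\sum_{k\le n}\Delta(k,p)=\frac{1}{\pi^{2}(p+1)}\,n^{2}+O(n\log n).$$
   Context: Here $\varphi$ denotes Euler's totient function, and for a prime $p$ and real $x\ge 1$, $\Delta(x,p)=\sum_{\substack{m\le x\\ p\mid m}}\varphi(m)$, the sum being over positive integers $m\le x$ divisible by $p$ (an empty sum is $0$). Sums over $k\le n$ run over the integers $1\le k\le n$. The constants implied by the $O$-terms are absolute (in particular independent of $p$).
   Formalization: The estimates are stated for n ≥ 2 instead of n ≥ 1: at n = 1 the sum is 0 and log n = 0 while the main term 1/(π²(p+1)) is positive, so the O-bounds fail there for every constant. *)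

theory Defs
  imports Complex_Main "HOL-Number_Theory.Totient"
begin

definition Delta :: "real \<Rightarrow> nat \<Rightarrow> nat" where
  "Delta x p = (\<Sum>m | 1 \<le> m \<and> real m \<le> x \<and> p dvd m. totient m)"

(* The index set in Delta is always finite, so the sum is never the junk value for infinite sets. *)
lemma finite_Delta_index: "finite {m. 1 \<le> m \<and> real m \<le> x \<and> p dvd m}"
  by (rule finite_subset[of _ "{..nat \<lfloor>x\<rfloor>}"]) (auto simp: le_nat_floor)

end

theory Submission
  imports Defs "HOL-Computational_Algebra.Squarefree" "HOL-Analysis.Gamma_Function"
begin

text \<open>
  Write \<open>\<Phi>(x)\<close> for the sum of \<open>\<phi>(m)\<close> over \<open>m \<le> x\<close>. The proof reduces the sum over multiples of \<open>p\<close>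
  to \<open>\<Phi>\<close>: since \<open>\<phi>(p j)\<close> is \<open>(p - 1) \<phi>(j)\<close>, plus a further \<open>\<phi>(j)\<close> when \<open>p\<close> divides \<open>j\<close>,
  \<open>\<Delta>(x,p) = (p - 1) \<Phi>(x/p) + \<Delta>(x/p,p)\<close>
  (lemma \<open>Delta_prime_recursion\<close>). If \<open>\<Phi>(y) = c y^2\<close> up to an error \<open>K y\<close>, this recursion is solved by
  \<open>c x^2 / (p + 1)\<close> up to the same error \<open>K x\<close>, because \<open>(p - 1) K x/p + K x/p = K x\<close>. That the error
  reproduces itself exactly is what makes the implied constant independent of \<open>p\<close>
  (lemma \<open>Delta_asymp\<close>; there \<open>K\<close> is a multiple of \<open>1 + ln X\<close>, with \<open>X\<close> an upper bound for all
  arguments).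

  For \<open>\<Phi>(x) = (3/\<pi>^2) x^2 + O(x (1 + ln x))\<close>, let \<open>F\<close> be the difference
  \<open>\<Phi>(x) - (3/\<pi>^2) x^2\<close>. The sum of \<open>F(x/e)\<close> over \<open>e \<le> x\<close> is only \<open>O(x)\<close>: the values \<open>\<Phi>(x/e)\<close> add up
  to \<open>\<lfloor>x\<rfloor> (\<lfloor>x\<rfloor> + 1) / 2\<close> by the identity that \<open>\<phi>\<close> summed over the divisors of \<open>m\<close> gives \<open>m\<close>, and the
  quadratic terms add up to \<open>x^2/2 + O(x)\<close> because the inverse squares sum to \<open>\<pi>^2/6\<close>. Moebius inversion
  recovers \<open>F(x)\<close> from these sums and costs a harmonic sum, hence the logarithm. The inversion is
  applied to the error term rather than to \<open>\<phi>\<close> itself, so that the constant comes directly from the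
  sum of the inverse squares and not from the series of \<open>\<mu>(d)/d^2\<close>.

  Finally the approximation of \<open>\<Delta>(k,p)\<close> is summed over \<open>k \<le> n\<close> (lemma \<open>sum_Delta_asymp\<close>).
\<close>

section \<open>Moebius inversion\<close>

definition moebius_mu :: "nat \<Rightarrow> real" where
  "moebius_mu n = (if squarefree n then (- 1) ^ card (prime_factors n) else 0)"

lemma moebius_mu_1 [simp]: "moebius_mu (Suc 0) = 1"
  by (simp add: moebius_mu_def flip: One_nat_def)

lemma abs_moebius_mu_le_1: "\<bar>moebius_mu n\<bar> \<le> 1"
  by (simp add: moebius_mu_def)

lemma moebius_mu_prime_mult:
  assumes p: "prime p" and nd: "\<not> p dvd d"
  shows "moebius_mu (p * d) = - moebius_mu d"
proof -
  have d0: "d \<noteq> 0" using nd by (metis dvd_0_right)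
  have p0: "p \<noteq> 0" using p by auto
  have cop: "coprime p d" using p nd by (simp add: prime_imp_coprime)
  have "squarefree (p * d) \<longleftrightarrow> squarefree d"
    using squarefree_mult_coprime[OF cop squarefree_prime[OF p]] squarefree_multD by blast
  moreover have "prime_factors (p * d) = insert p (prime_factors d)"
    using d0 p0 p by (auto simp: prime_factorization_mult prime_factorization_prime)
  moreover have "p \<notin> prime_factors d" using nd by auto
  ultimately show ?thesis by (simp add: moebius_mu_def)
qed

text \<open>
  For a prime \<open>p\<close> dividing \<open>n\<close>, the squarefree divisors of \<open>n\<close> come in pairs \<open>d\<close>, \<open>p d\<close> with
  \<open>p\<close> not dividing \<open>d\<close>, and the two members of a pair have opposite signs.
\<close>
lemma sum_moebius_mu_divisors:
  assumes "n > 0"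
  shows "(\<Sum>d | d dvd n. moebius_mu d) = (if n = 1 then 1 else 0)"
proof (cases "n = 1")
  case False
  then obtain p where p: "prime p" "p dvd n" using prime_factor_nat by blast
  have fin: "finite {d. d dvd n}" using assms by simp
  let ?A = "{d. d dvd n \<and> squarefree d \<and> \<not> p dvd d}"
  let ?B = "{d. d dvd n \<and> squarefree d \<and> p dvd d}"
  have finA: "finite ?A" and finB: "finite ?B"
    by (rule finite_subset[OF _ fin]; auto)+
  have "(\<Sum>d | d dvd n. moebius_mu d) = (\<Sum>d\<in>?A \<union> ?B. moebius_mu d)"
    by (rule sum.mono_neutral_right) (use fin in \<open>auto simp: moebius_mu_def\<close>)
  also have "\<dots> = (\<Sum>d\<in>?A. moebius_mu d) + (\<Sum>d\<in>?B. moebius_mu d)"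
    using finA finB by (intro sum.union_disjoint) auto
  also have "(\<Sum>d\<in>?B. moebius_mu d) = (\<Sum>d\<in>?A. moebius_mu (p * d))"
  proof (rule sum.reindex_bij_witness[where i = "\<lambda>d. p * d" and j = "\<lambda>d. d div p"])
    fix b assume b: "b \<in> ?B"
    show "p * (b div p) = b" using b by auto
    show "moebius_mu (p * (b div p)) = moebius_mu b" using b by auto
    have "\<not> p dvd b div p"
    proof
      assume "p dvd b div p"
      then have "p ^ 2 dvd b" using b
        by (metis (mono_tags, lifting) mem_Collect_eq dvd_div_mult_self mult_dvd_mono dvd_refl power2_eq_square)
      then have "is_unit p" using b by (auto dest: squarefreeD)
      then show False using p by auto
    qed
    moreover have "b div p dvd b" using b by (metis (mono_tags, lifting) mem_Collect_eq dvd_def dvd_div_mult_self)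
    ultimately show "b div p \<in> ?A" using b by (auto intro: dvd_trans squarefree_mono)
  next
    fix a assume a: "a \<in> ?A"
    have "coprime p a" using a p by (simp add: prime_imp_coprime)
    then show "p * a \<in> ?B" using a p
      by (auto intro: divides_mult squarefree_mult_coprime squarefree_prime)
    show "p * a div p = a" using p by (auto simp: prime_gt_0_nat)
  qed
  also have "\<dots> = - (\<Sum>d\<in>?A. moebius_mu d)"
    using p by (simp add: moebius_mu_prime_mult sum_negf)
  finally show ?thesis using False by simp
qed simp

text \<open>
  Both sides run over the pairs \<open>(d, e)\<close> with \<open>d e \<le> N\<close>; on the right they are grouped by the
  product \<open>m = d e\<close>.
\<close>
lemma sum_below_div_eq_sum_divisors:
  fixes f :: "nat \<Rightarrow> nat \<Rightarrow> real"
  shows "(\<Sum>d=1..N. \<Sum>e=1..N div d. f d (d * e)) = (\<Sum>m=1..N. \<Sum>d | d dvd m. f d m)"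
proof -
  have le: "b \<le> N" if "b * k \<le> N" "Suc 0 \<le> k" for b k
    using that by (cases k) auto
  have "(\<Sum>d=1..N. \<Sum>e=1..N div d. f d (d * e)) =
    (\<Sum>(d,e)\<in>(SIGMA d:{1..N}. {1..N div d}). f d (d * e))"
    by (simp add: sum.Sigma)
  also have "\<dots> = (\<Sum>(m,d)\<in>(SIGMA m:{1..N}. {d. d dvd m}). f d m)"
    by (rule sum.reindex_bij_witness[where i = "\<lambda>(m,d). (d, m div d)" and j = "\<lambda>(d,e). (d * e, d)"])
       (auto simp: less_eq_div_iff_mult_less_eq mult.commute
         elim!: dvdE intro: Suc_leI dest: le)
  also have "\<dots> = (\<Sum>m=1..N. \<Sum>d | d dvd m. f d m)"
    by (subst sum.Sigma) auto
  finally show ?thesis .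
qed

lemma nat_floor_divide: "nat \<lfloor>x / real d\<rfloor> = nat \<lfloor>x\<rfloor> div d"
  using floor_divide_real_eq_div[of "int d" x] by (simp add: nat_div_distrib')

text \<open>
  After grouping by \<open>m = d e\<close>, the coefficient of \<open>F(x/m)\<close> is the divisor sum of \<open>\<mu>\<close> at \<open>m\<close>, so only
  \<open>m = 1\<close> survives.
\<close>
lemma moebius_inversion_real:
  fixes F :: "real \<Rightarrow> real"
  assumes "x \<ge> 1"
  shows "F x = (\<Sum>d=1..nat \<lfloor>x\<rfloor>. moebius_mu d * (\<Sum>e=1..nat \<lfloor>x / real d\<rfloor>. F (x / real d / real e)))"
proof -
  define N where "N = nat \<lfloor>x\<rfloor>"
  have N: "N \<ge> 1" using assms by (simp add: N_def le_nat_floor)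
  have "(\<Sum>d=1..N. moebius_mu d * (\<Sum>e=1..nat \<lfloor>x / real d\<rfloor>. F (x / real d / real e)))
      = (\<Sum>d=1..N. \<Sum>e=1..N div d. moebius_mu d * F (x / real (d * e)))"
    by (simp add: nat_floor_divide N_def sum_distrib_left)
  also have "\<dots> = (\<Sum>m=1..N. \<Sum>d | d dvd m. moebius_mu d * F (x / real m))"
    by (rule sum_below_div_eq_sum_divisors)
  also have "\<dots> = (\<Sum>m=1..N. if m = 1 then F x else 0)"
    by (intro sum.cong refl) (auto simp: sum_moebius_mu_divisors simp flip: sum_distrib_right)
  also have "\<dots> = F x" using N by (simp add: sum.delta)
  finally show ?thesis by (simp add: N_def)
qed

section \<open>The summatory function of the totient\<close>

definition totient_summatory :: "real \<Rightarrow> real" where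
  "totient_summatory x = (\<Sum>m=1..nat \<lfloor>x\<rfloor>. real (totient m))"

text \<open>
  The left side counts \<open>\<phi>(e)\<close> once for every pair with \<open>d e \<le> x\<close>; the pairs with product \<open>m\<close> contribute the
  sum of \<open>\<phi>\<close> over the divisors of \<open>m\<close>, which is \<open>m\<close>.
\<close>
lemma sum_totient_summatory:
  "(\<Sum>d=1..nat \<lfloor>x\<rfloor>. totient_summatory (x / real d)) = real (nat \<lfloor>x\<rfloor>) * (real (nat \<lfloor>x\<rfloor>) + 1) / 2"
proof -
  define N where "N = nat \<lfloor>x\<rfloor>"
  \<comment> \<open>Writing \<open>e\<close> as \<open>d * e div d\<close> gives the summand the shape \<open>f d (d * e)\<close>.\<close>
  have "(\<Sum>d=1..N. totient_summatory (x / real d)) = (\<Sum>d=1..N. \<Sum>e=1..N div d. real (totient (d * e div d)))"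
    by (simp add: totient_summatory_def nat_floor_divide N_def)
  also have "\<dots> = (\<Sum>m=1..N. \<Sum>d | d dvd m. real (totient (m div d)))"
    by (rule sum_below_div_eq_sum_divisors)
  also have "\<dots> = (\<Sum>m=1..N. real m)"
  proof (rule sum.cong[OF refl])
    fix m assume m: "m \<in> {1..N}"
    have "(\<Sum>d | d dvd m. real (totient (m div d))) = (\<Sum>d | d dvd m. real (totient d))"
      by (rule sum.reindex_bij_witness[where i = "\<lambda>d. m div d" and j = "\<lambda>d. m div d"])
         (use m in \<open>auto elim!: dvdE\<close>)
    also have "\<dots> = real m" by (simp only: totient_divisor_sum flip: of_nat_sum)
    finally show "(\<Sum>d | d dvd m. real (totient (m div d))) = real m" .
  qed
  also have "\<dots> = real N * (real N + 1) / 2"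
    by (induction N) (auto simp: field_simps)
  finally show ?thesis by (simp add: N_def)
qed

text \<open>
  By telescoping, \<open>1/(N+1)^2 \<le> 1/N - 1/(N+1)\<close>, so adding \<open>1/N\<close> to the partial sums turns them into a sequence
  that decreases to the same limit.
\<close>
lemma basel_tail_bounds:
  assumes "N \<ge> 1"
  shows "(\<Sum>e=1..N. 1 / real e ^ 2) \<le> pi ^ 2 / 6"
    and "pi ^ 2 / 6 \<le> (\<Sum>e=1..N. 1 / real e ^ 2) + 1 / real N"
proof -
  define a where "a n = (\<Sum>e=1..n. 1 / real e ^ 2)" for n
  have lim: "a \<longlonglongrightarrow> pi ^ 2 / 6"
    using inverse_squares_sums
    by (simp add: sums_def a_def[abs_def] sum.atLeast1_atMost_eq add.commute)
  have "incseq a" by (intro incseq_SucI) (simp add: a_def)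
  from incseq_le[OF this lim] show "(\<Sum>e=1..N. 1 / real e ^ 2) \<le> pi ^ 2 / 6"
    by (simp add: a_def)
  \<comment> \<open>The index is shifted because \<open>1 / real 0 = 0\<close> would break monotonicity at \<open>0\<close>.\<close>
  define b where "b n = a (Suc n) + 1 / real (Suc n)" for n
  have "decseq b"
  proof (rule decseq_SucI)
    fix n
    have "1 / real (n + 2) ^ 2 \<le> 1 / (real (n + 1) * real (n + 2))"
      by (intro divide_left_mono) (auto simp: power2_eq_square)
    also have "\<dots> = 1 / real (n + 1) - 1 / real (n + 2)" by (simp add: field_simps)
    finally show "b (Suc n) \<le> b n" by (simp add: b_def a_def)
  qed
  moreover have "b \<longlonglongrightarrow> pi ^ 2 / 6 + 0" unfolding b_def
    by (intro tendsto_add LIMSEQ_Suc[OF lim] LIMSEQ_Suc[OF lim_1_over_n])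
  ultimately have "pi ^ 2 / 6 \<le> b (N - 1)" using decseq_ge by fastforce
  then show "pi ^ 2 / 6 \<le> (\<Sum>e=1..N. 1 / real e ^ 2) + 1 / real N"
    using assms by (simp add: b_def a_def)
qed

lemma harm_le_1_plus_ln: "n \<ge> 1 \<Longrightarrow> harm n \<le> 1 + ln (real n)"
  using decseqD[OF decseq_harm_diff_ln, of 0 "n - 1"] by (simp add: harm_expand)

text \<open>
  The constant \<open>3/\<pi>^2\<close> is the one for which the two quadratic main terms \<open>x^2/2\<close> cancel. What
  remains is at most \<open>x\<close> from replacing \<open>x\<close> by its integer part and at most \<open>x\<close> from the tail of the series
  of inverse squares.
\<close>
lemma sum_totient_error_bound:
  fixes x :: real
  assumes "x \<ge> 1"
  shows "\<bar>\<Sum>e=1..nat \<lfloor>x\<rfloor>. totient_summatory (x / real e) - 3 / pi ^ 2 * (x / real e) ^ 2\<bar> \<le> 2 * x"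
proof -
  define N where "N = nat \<lfloor>x\<rfloor>"
  define S where "S = (\<Sum>e=1..N. 1 / real e ^ 2)"
  have N: "N \<ge> 1" using assms by (simp add: N_def le_nat_floor)
  have Nx: "real N \<le> x" "x < real N + 1" using assms by (simp_all add: N_def)
  have c: "3 / pi ^ 2 \<le> 1 / 2"
  proof -
    have "3 ^ 2 \<le> pi ^ 2" using pi_gt3 by (intro power_mono) auto
    then show ?thesis by (simp add: field_simps)
  qed
  have main: "(\<Sum>e=1..N. totient_summatory (x / real e) - 3 / pi ^ 2 * (x / real e) ^ 2)
      = real N * (real N + 1) / 2 - 3 / pi ^ 2 * x ^ 2 * S"
    unfolding sum_subtractf S_def sum_distrib_left
    using sum_totient_summatory[of x] by (simp add: N_def power_divide)
  have S: "S \<le> pi ^ 2 / 6" "pi ^ 2 / 6 - 1 / real N \<le> S"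
    using basel_tail_bounds[OF N] by (simp_all add: S_def)
  have q: "3 / pi ^ 2 * x ^ 2 \<ge> 0" by simp
  have up: "3 / pi ^ 2 * x ^ 2 * S \<le> x ^ 2 / 2"
    using mult_left_mono[OF S(1) q] by simp
  have "x ^ 2 / 2 - 3 / pi ^ 2 * x ^ 2 / real N = 3 / pi ^ 2 * x ^ 2 * (pi ^ 2 / 6 - 1 / real N)"
    by (simp add: field_simps)
  also have "\<dots> \<le> 3 / pi ^ 2 * x ^ 2 * S" by (rule mult_left_mono[OF S(2) q])
  finally have lo: "x ^ 2 / 2 - 3 / pi ^ 2 * x ^ 2 / real N \<le> 3 / pi ^ 2 * x ^ 2 * S" .
  have "3 / pi ^ 2 * x ^ 2 / real N \<le> 1 / 2 * x ^ 2 / real N"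
    by (intro divide_right_mono mult_right_mono c) auto
  also have "\<dots> \<le> x"
  proof -
    have "x * x \<le> x * (2 * real N)" using assms Nx N by (intro mult_left_mono) auto
    then show ?thesis using N by (simp add: field_simps power2_eq_square)
  qed
  finally have tail: "3 / pi ^ 2 * x ^ 2 / real N \<le> x" .
  have "real N ^ 2 \<le> x ^ 2" "x ^ 2 \<le> (real N + 1) ^ 2"
    using Nx assms by (auto intro!: power_mono)
  moreover have "real N * (real N + 1) / 2 = real N ^ 2 / 2 + real N / 2"
    "(real N + 1) ^ 2 = real N ^ 2 + 2 * real N + 1"
    by (simp_all add: power2_eq_square field_simps)
  ultimately have "\<bar>real N * (real N + 1) / 2 - 3 / pi ^ 2 * x ^ 2 * S\<bar> \<le> 2 * x"
    using up lo tail Nx N assms unfolding abs_le_iff by linarith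
  then show ?thesis unfolding N_def[symmetric] main .
qed

text \<open>
  By inversion the error at \<open>x\<close> is a sum of \<open>\<mu>(d)\<close> times quantities bounded by \<open>2 x/d\<close>; the harmonic
  sum of the \<open>1/d\<close> produces the logarithm.
\<close>
lemma totient_summatory_asymp:
  assumes "x \<ge> 1"
  shows "\<bar>totient_summatory x - 3 / pi ^ 2 * x ^ 2\<bar> \<le> 2 * x * (1 + ln x)"
proof -
  define N where "N = nat \<lfloor>x\<rfloor>"
  have N: "N \<ge> 1" using assms by (simp add: N_def le_nat_floor)
  have Nx: "real N \<le> x" using assms by (simp add: N_def)
  define F where "F y = totient_summatory y - 3 / pi ^ 2 * y ^ 2" for y
  have G: "\<bar>\<Sum>e=1..nat \<lfloor>y\<rfloor>. F (y / real e)\<bar> \<le> 2 * y" if "y \<ge> 1" for y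
    using sum_totient_error_bound[OF that] by (simp add: F_def)
  have "\<bar>F x\<bar> \<le> (\<Sum>d=1..N. \<bar>moebius_mu d * (\<Sum>e=1..nat \<lfloor>x / real d\<rfloor>. F (x / real d / real e))\<bar>)"
    unfolding moebius_inversion_real[OF assms, of F] N_def by (rule sum_abs)
  also have "\<dots> \<le> (\<Sum>d=1..N. 2 * x * inverse (real d))"
  proof (rule sum_mono)
    fix d assume d: "d \<in> {1..N}"
    then have "real d \<le> x" using Nx by (meson atLeastAtMost_iff of_nat_mono order_trans)
    then have "x / real d \<ge> 1" using d by simp
    from mult_mono[OF abs_moebius_mu_le_1[of d] G[OF this]]
    show "\<bar>moebius_mu d * (\<Sum>e=1..nat \<lfloor>x / real d\<rfloor>. F (x / real d / real e))\<bar> \<le> 2 * x * inverse (real d)"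
      by (simp add: abs_mult field_simps)
  qed
  also have "\<dots> = 2 * x * harm N" by (simp add: harm_def sum_distrib_left)
  also have "\<dots> \<le> 2 * x * (1 + ln x)"
  proof (rule mult_left_mono)
    have "harm N \<le> 1 + ln (real N)" by (rule harm_le_1_plus_ln[OF N])
    also have "\<dots> \<le> 1 + ln x" using Nx N by simp
    finally show "harm N \<le> 1 + ln x" .
  qed (use assms in simp)
  finally show ?thesis by (simp add: F_def)
qed

section \<open>Restriction to multiples of a prime\<close>

lemma totient_prime_mult:
  assumes "prime p"
  shows "totient (p * j) = (p - 1) * totient j + (if p dvd j then totient j else 0)"
proof (cases "p dvd j")
  case True
  have "totient (p * j) * totient (gcd p j) = totient p * totient j * gcd p j"
    by (rule totient_gcd)
  moreover have "gcd p j = p" using True by (simp add: gcd_nat.absorb1)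
  moreover have "totient p > 0" using assms prime_gt_0_nat by simp
  ultimately have "totient (p * j) = p * totient j" by simp
  then show ?thesis using True prime_gt_0_nat[OF assms]
    by (cases p) auto
next
  case False
  then have "coprime p j" using assms by (simp add: prime_imp_coprime)
  then show ?thesis using False assms by (simp add: totient_mult_coprime totient_prime)
qed

lemma Delta_altdef: "Delta x p = (\<Sum>m | m \<in> {1..nat \<lfloor>x\<rfloor>} \<and> p dvd m. totient m)"
proof -
  have "real m \<le> x \<longleftrightarrow> m \<le> nat \<lfloor>x\<rfloor>" if "m \<ge> 1" for m
    using that by linarith
  then show ?thesis unfolding Delta_def by (intro sum.cong) auto
qed

lemma Delta_prime_recursion:
  assumes p: "prime p"
  shows "real (Delta x p) = (real p - 1) * totient_summatory (x / real p) + real (Delta (x / real p) p)"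
proof -
  define M where "M = nat \<lfloor>x / real p\<rfloor>"
  have p0: "p > 0" using p by (rule prime_gt_0_nat)
  have M: "M = nat \<lfloor>x\<rfloor> div p" by (simp add: M_def nat_floor_divide)
  have "Delta x p = (\<Sum>j=1..M. totient (p * j))"
    unfolding Delta_altdef
    by (rule sum.reindex_bij_witness[where i = "\<lambda>j. p * j" and j = "\<lambda>m. m div p"])
       (use p0 in \<open>auto simp: M less_eq_div_iff_mult_less_eq mult.commute elim!: dvdE\<close>)
  also have "\<dots> = (p - 1) * (\<Sum>j=1..M. totient j) + (\<Sum>j=1..M. if p dvd j then totient j else 0)"
    by (simp add: totient_prime_mult[OF p] sum.distrib sum_distrib_left)
  also have "(\<Sum>j=1..M. if p dvd j then totient j else 0) = Delta (x / real p) p"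
    unfolding Delta_altdef M_def[symmetric]
    by (rule sum.inter_filter[symmetric]) simp
  finally show ?thesis using p0
    by (simp add: totient_summatory_def M_def of_nat_diff)
qed

text \<open>
  Induction on \<open>\<lfloor>x\<rfloor>\<close> through the recursion for \<open>\<Delta>\<close>. The main terms match because
  \<open>(p - 1) + 1/(p + 1) = p^2/(p + 1)\<close>. The logarithmic factor is taken at a fixed \<open>X\<close> bounding all arguments,
  so that it does not change from one step to the next, and small arguments \<open>0 \<le> x < 1\<close> are included
  because the recursion descends to them.
\<close>
lemma Delta_asymp:
  assumes p: "prime p" and "X \<ge> 1" and "0 \<le> x" "x \<le> X"
  shows "\<bar>real (Delta x p) - 3 / (pi ^ 2 * (real p + 1)) * x ^ 2\<bar> \<le> 2 * x * (1 + ln X)"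
  using assms(3,4)
proof (induction "nat \<lfloor>x\<rfloor>" arbitrary: x rule: less_induct)
  case less
  define c where "c = 3 / pi ^ 2"
  define L where "L = 1 + ln X"
  have L: "L \<ge> 1" using assms by (simp add: L_def)
  have p2: "real p \<ge> 2" using prime_ge_2_nat[OF p] by simp
  have c: "c \<ge> 0" "c \<le> 1 / 2"
  proof -
    have "3 ^ 2 \<le> pi ^ 2" using pi_gt3 by (intro power_mono) auto
    then show "c \<le> 1 / 2" by (simp add: c_def field_simps)
  qed (simp add: c_def)
  \<comment> \<open>Below 1 both counting functions vanish, and the main term itself fits into the error.\<close>
  have small: "c * y ^ 2 \<le> 2 * y * L" if "0 \<le> y" "y < 1" for y
  proof -
    have "c * y ^ 2 \<le> 1 / 2 * y ^ 2" using c by (intro mult_right_mono) auto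
    also have "\<dots> \<le> 2 * (y * 1)" using that mult_mono[of y 1 y y] by (simp add: power2_eq_square)
    also have "\<dots> \<le> 2 * (y * L)" using that L by (intro mult_left_mono) auto
    finally show ?thesis by simp
  qed
  show ?case
  proof (cases "x < 1")
    case True
    then have "Delta x p = 0" by (simp add: Delta_altdef)
    moreover have "c / (real p + 1) * x ^ 2 \<le> c * x ^ 2"
      using c p2 by (intro mult_right_mono) (auto simp: field_simps)
    moreover have "c / (real p + 1) * x ^ 2 \<ge> 0" using c by simp
    ultimately show ?thesis using small[of x] less.prems True
      by (simp add: c_def L_def mult.commute)
  next
    case False
    define y where "y = x / real p"
    have y: "0 \<le> y" "y \<le> X" "x = real p * y" "y \<le> x"
      using less.prems p2 False by (auto simp: y_def field_simps intro: order_trans)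
    have "nat \<lfloor>y\<rfloor> < nat \<lfloor>x\<rfloor>"
      using False p2 prime_ge_2_nat[OF p] by (simp add: y_def nat_floor_divide)
    from less.hyps[OF this y(1,2)]
    have IH: "\<bar>real (Delta y p) - c / (real p + 1) * y ^ 2\<bar> \<le> 2 * y * L"
      by (simp add: c_def L_def)
    have Phi: "\<bar>totient_summatory y - c * y ^ 2\<bar> \<le> 2 * y * L"
    proof (cases "y < 1")
      case True
      then have "totient_summatory y = 0" by (simp add: totient_summatory_def)
      then show ?thesis using small[of y] y True c by simp
    next
      case False
      then have "\<bar>totient_summatory y - c * y ^ 2\<bar> \<le> 2 * y * (1 + ln y)"
        using totient_summatory_asymp[of y] by (simp add: c_def)
      also have "\<dots> \<le> 2 * y * L" unfolding L_def using y False
        by (intro mult_left_mono) auto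
      finally show ?thesis .
    qed
    have "real (Delta x p) - c / (real p + 1) * x ^ 2
      = (real p - 1) * (totient_summatory y - c * y ^ 2) + (real (Delta y p) - c / (real p + 1) * y ^ 2)"
      using p2 unfolding Delta_prime_recursion[OF p, of x] y_def[symmetric] unfolding y(3)
      by (simp add: divide_simps) (simp add: algebra_simps power2_eq_square)
    also have "\<bar>\<dots>\<bar> \<le> (real p - 1) * (2 * y * L) + 2 * y * L"
      using p2 Phi IH
      by (intro order_trans[OF abs_triangle_ineq] add_mono) (auto simp: abs_mult intro!: mult_left_mono)
    also have "\<dots> = 2 * x * L" by (simp add: y(3) algebra_simps)
    finally show ?thesis by (simp add: c_def L_def)
  qed
qed

text \<open>
  The main terms give a multiple of the sum of the squares up to \<open>n\<close>, that is \<open>n^3/3\<close> up to \<open>n^2\<close>.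
  Since \<open>ln n \<ge> 2/3\<close> for \<open>n \<ge> 2\<close>, the error terms without logarithm are absorbed: \<open>2\<close> comes from the
  logarithmic part, and \<open>2 + 1/2\<close> times \<open>3/2\<close> from the rest, less than \<open>7\<close> together.
\<close>
lemma sum_Delta_asymp:
  assumes p: "prime p" and n: "n \<ge> 2"
  shows "\<bar>(\<Sum>k=1..n. real (Delta (real k) p)) - 1 / (pi ^ 2 * (real p + 1)) * real n ^ 3\<bar>
    \<le> 7 * (real n ^ 2 * ln (real n))"
proof -
  define a where "a = 3 / (pi ^ 2 * (real p + 1))"
  define S where "S = (\<Sum>k=1..n. real (Delta (real k) p))"
  define L where "L = ln (real n)"
  have a: "0 \<le> a" "a \<le> 1 / 2"
  proof -
    have "3 ^ 2 \<le> pi ^ 2" using pi_gt3 by (intro power_mono) auto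
    then have "6 * 1 \<le> pi ^ 2 * (real p + 1)" by (intro mult_mono) auto
    then show "a \<le> 1 / 2" by (simp add: a_def divide_simps)
  qed (simp add: a_def)
  have L: "L \<ge> 2 / 3"
    using ln2_ge_two_thirds n ln_le_cancel_iff[of 2 "real n"] by (simp add: L_def del: ln_le_cancel_iff)
  have squares: "(\<Sum>k=1..n. real k ^ 2) = real n ^ 3 / 3 + real n ^ 2 / 2 + real n / 6"
    by (induction n) (auto simp: field_simps power2_eq_square power3_eq_cube)
  have "\<bar>S - a * (\<Sum>k=1..n. real k ^ 2)\<bar> = \<bar>\<Sum>k=1..n. real (Delta (real k) p) - a * real k ^ 2\<bar>"
    by (simp add: S_def sum_subtractf sum_distrib_left)
  also have "\<dots> \<le> (\<Sum>k=1..n. 2 * real n * (1 + L))"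
  proof (rule order_trans[OF sum_abs sum_mono])
    fix k assume k: "k \<in> {1..n}"
    have "\<bar>real (Delta (real k) p) - a * real k ^ 2\<bar> \<le> 2 * real k * (1 + L)"
      using Delta_asymp[OF p, of "real n" "real k"] n k by (simp add: a_def L_def)
    also have "\<dots> \<le> 2 * real n * (1 + L)" using k L by (intro mult_right_mono) auto
    finally show "\<bar>real (Delta (real k) p) - a * real k ^ 2\<bar> \<le> 2 * real n * (1 + L)" .
  qed
  also have "\<dots> = 2 * real n ^ 2 + 2 * (real n ^ 2 * L)" by (simp add: algebra_simps power2_eq_square)
  finally have 1: "\<bar>S - a * (\<Sum>k=1..n. real k ^ 2)\<bar> \<le> 2 * real n ^ 2 + 2 * (real n ^ 2 * L)" .
  have "real n * 1 \<le> real n * real n" using n by (intro mult_left_mono) auto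
  then have "real n ^ 2 / 2 + real n / 6 \<le> real n ^ 2" by (simp add: power2_eq_square)
  then have "a * (real n ^ 2 / 2 + real n / 6) \<le> 1 / 2 * real n ^ 2" using a by (intro mult_mono) auto
  moreover have "a * (real n ^ 2 / 2 + real n / 6) \<ge> 0" using a by simp
  moreover have "a * (\<Sum>k=1..n. real k ^ 2) = a / 3 * real n ^ 3 + a * (real n ^ 2 / 2 + real n / 6)"
    unfolding squares by (simp add: algebra_simps)
  moreover have "real n ^ 2 * (2 / 3) \<le> real n ^ 2 * L" by (rule mult_left_mono[OF L]) simp
  ultimately have "\<bar>S - a / 3 * real n ^ 3\<bar> \<le> 7 * (real n ^ 2 * L)"
    using 1 unfolding abs_le_iff by linarith
  then show ?thesis by (simp add: S_def a_def L_def)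
qed

(* The implied constants C are quantified before p, hence absolute.  The range is n >= 2
   because ln 1 = 0, whereas Delta 1 p = 0 and the main term is nonzero. *)
theorem theorem5p2:
  "(\<exists>C::real. \<forall>p n :: nat. prime p \<longrightarrow> n \<ge> 2 \<longrightarrow>
      \<bar>(\<Sum>k=1..n. real (Delta (real k) p)) - 1 / (pi ^ 2 * (real p + 1)) * real n ^ 3\<bar>
        \<le> C * (real n ^ 2 * ln (real n))) \<and>
   (\<exists>C::real. \<forall>p n :: nat. prime p \<longrightarrow> n \<ge> 2 \<longrightarrow>
      \<bar>1 / real n * (\<Sum>k=1..n. real (Delta (real k) p)) - 1 / (pi ^ 2 * (real p + 1)) * real n ^ 2\<bar>
        \<le> C * (real n * ln (real n)))"
proof (intro conjI exI[of _ 7] allI impI)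
  fix p n :: nat
  assume p: "prime p" and n: "n \<ge> 2"
  define S where "S = (\<Sum>k=1..n. real (Delta (real k) p))"
  define c where "c = 1 / (pi ^ 2 * (real p + 1))"
  have *: "\<bar>S - c * real n ^ 3\<bar> \<le> 7 * (real n ^ 2 * ln (real n))"
    unfolding S_def c_def by (rule sum_Delta_asymp[OF p n])
  then show "\<bar>(\<Sum>k=1..n. real (Delta (real k) p)) - 1 / (pi ^ 2 * (real p + 1)) * real n ^ 3\<bar>
        \<le> 7 * (real n ^ 2 * ln (real n))"
    by (simp only: S_def c_def)
  have "1 / real n * S - c * real n ^ 2 = (S - c * real n ^ 3) / real n"
    using n by (simp add: field_simps power2_eq_square power3_eq_cube)
  also have "\<bar>\<dots>\<bar> \<le> 7 * (real n ^ 2 * ln (real n)) / real n"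
    using divide_right_mono[OF *, of "real n"] by simp
  also have "\<dots> = 7 * (real n * ln (real n))"
    using n by (simp add: power2_eq_square)
  finally show "\<bar>1 / real n * (\<Sum>k=1..n. real (Delta (real k) p)) - 1 / (pi ^ 2 * (real p + 1)) * real n ^ 2\<bar>
        \<le> 7 * (real n * ln (real n))"
    by (simp only: S_def c_def)
qed

end
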